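(* There exists a unique algebra homomorphism $\natural:\mathcal H\rightarrow U(\mathfrak{sl}_2)$ that sends $$A\mapsto \frac{H}{4},\qquad B\mapsto \frac{E^2+F^2+\Lambda-1}{4}-\frac{H^2}{8},\qquad C\mapsto \frac{E^2-F^2}{4},\qquad \alpha\mapsto \frac{\Lambda-1}{4},\qquad \beta\mapsto 0.$$
   Context: All algebras are unital associative algebras over $\mathbb C$, algebra homomorphisms are unital, and $[x,y]=xy-yx$. $U(\mathfrak{sl}_2)$ is the algebra over $\mathbb C$ generated by $E,F,H$ subject to the relations $[H,E]=2E$, $[H,F]=-2F$, $[E,F]=H$. Its Casimir element is $\Lambda=EF+FE+\frac{H^2}{2}$, which is central in $U(\mathfrak{sl}_2)$. The universal Hahn algebra $\mathcal H$ is the algebra over $\mathbb C$ generated by $A,B,C$ with the relations asserting that $[A,B]=C$ and that each of the elements $\alpha=[C,A]+2A^2+B$ and $\beta=[B,C]+4BA+2C$ is central in $\mathcal H$ (i.e. commutes with $A,B,C$). *)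

theory Defs
  imports Complex_Main "HOL-Library.Poly_Mapping"
begin

section \<open>Unital associative algebras over the complex numbers\<close>

text \<open>
  The class \<open>ring_1\<close> of the library is not used here because it requires \<open>0 \<noteq> 1\<close>, whereas an
  algebra given by generators and relations may be zero; \<open>semiring_numeral\<close> supplies the unit and
  adds no further axiom.
\<close>

class complex_algebra_1 = ring + semiring_numeral +
  fixes scaleC :: "complex \<Rightarrow> 'a \<Rightarrow> 'a"  (infixr "*\<^sub>C" 75)
  assumes scaleC_add_right: "c *\<^sub>C (x + y) = c *\<^sub>C x + c *\<^sub>C y"
    and scaleC_add_left: "(c + d) *\<^sub>C x = c *\<^sub>C x + d *\<^sub>C x"
    and scaleC_scaleC: "c *\<^sub>C d *\<^sub>C x = (c * d) *\<^sub>C x"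
    and scaleC_one: "1 *\<^sub>C x = x"
    and mult_scaleC_left: "(c *\<^sub>C x) * y = c *\<^sub>C (x * y)"
    and mult_scaleC_right: "x * (c *\<^sub>C y) = c *\<^sub>C (x * y)"

definition complex_algebra_hom ::
    "('a::complex_algebra_1 \<Rightarrow> 'b::complex_algebra_1) \<Rightarrow> bool" where
  "complex_algebra_hom h \<longleftrightarrow>
     (\<forall>x y. h (x + y) = h x + h y) \<and>
     (\<forall>c x. h (c *\<^sub>C x) = c *\<^sub>C h x) \<and>
     (\<forall>x y. h (x * y) = h x * h y) \<and>
     h 1 = 1"

definition commutator :: "'a::ring \<Rightarrow> 'a \<Rightarrow> 'a" where
  "commutator x y = x * y - y * x"


section \<open>Free algebras\<close>

text \<open>
  The free monoid of words is written additively because the convolution product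
  of finitely supported functions uses addition on the keys; addition of words is
  concatenation and is not commutative.
\<close>

datatype 'g word = Word (letters: "'g list")

instantiation word :: (type) monoid_add
begin

definition zero_word :: "'a word" where
  "zero_word = Word []"

definition plus_word :: "'a word \<Rightarrow> 'a word \<Rightarrow> 'a word" where
  "plus_word u v = Word (letters u @ letters v)"

instance
  by standard (simp_all add: zero_word_def plus_word_def)

end

type_synonym 'g free_algebra = "'g word \<Rightarrow>\<^sub>0 complex"

definition free_gen :: "'g \<Rightarrow> 'g free_algebra" where
  "free_gen g = Poly_Mapping.single (Word [g]) 1"

definition free_const :: "complex \<Rightarrow> 'g free_algebra" where
  "free_const c = Poly_Mapping.single 0 c"

lemma free_const_add: "free_const (c + d) = free_const c + free_const d"
  by (simp add: free_const_def single_add)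

lemma free_const_mult: "free_const (c * d) = free_const c * free_const d"
  by (simp add: free_const_def mult_single)

lemma free_const_1: "free_const 1 = 1"
  by (simp add: free_const_def)

lemma free_const_commute: "free_const c * p = p * free_const c" for p :: "'g free_algebra"
proof (induction p rule: update_induct)
  case const
  show ?case by simp
next
  case (update p w a)
  have "Poly_Mapping.update w a p = p + Poly_Mapping.single w a"
    using update.hyps(1)
    by (intro poly_mapping_eqI) (auto simp: lookup_update lookup_add lookup_single in_keys_iff)
  moreover have "free_const c * Poly_Mapping.single w a = Poly_Mapping.single w a * free_const c"
    by (simp add: free_const_def mult_single mult.commute)
  ultimately show ?case
    using update.IH by (simp add: distrib_left distrib_right)
qed

lemma free_const_left_commute:
  "p * (free_const c * q) = free_const c * (p * q)" for p q :: "'g free_algebra"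
  by (metis free_const_commute mult.assoc)


section \<open>Algebras given by generators and relations\<close>

inductive_set two_sided_ideal :: "'a::ring_1 set \<Rightarrow> 'a set" for R where
  zero: "0 \<in> two_sided_ideal R"
| gen: "r \<in> R \<Longrightarrow> r \<in> two_sided_ideal R"
| add: "x \<in> two_sided_ideal R \<Longrightarrow> y \<in> two_sided_ideal R \<Longrightarrow> x + y \<in> two_sided_ideal R"
| mult_left: "x \<in> two_sided_ideal R \<Longrightarrow> a * x \<in> two_sided_ideal R"
| mult_right: "x \<in> two_sided_ideal R \<Longrightarrow> x * a \<in> two_sided_ideal R"

lemma two_sided_ideal_uminus: "x \<in> two_sided_ideal R \<Longrightarrow> - x \<in> two_sided_ideal R"
  using two_sided_ideal.mult_left[of x R "- 1"] by simp

lemma two_sided_ideal_minus_commute: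
  "x - y \<in> two_sided_ideal R \<Longrightarrow> y - x \<in> two_sided_ideal R"
  using two_sided_ideal_uminus[of "x - y" R] by simp

lemma two_sided_ideal_minus_trans:
  "x - y \<in> two_sided_ideal R \<Longrightarrow> y - z \<in> two_sided_ideal R \<Longrightarrow> x - z \<in> two_sided_ideal R"
  using two_sided_ideal.add[of "x - y" R "y - z"] by simp

lemma two_sided_ideal_minus_mult:
  assumes "x - x' \<in> two_sided_ideal R" "y - y' \<in> two_sided_ideal R"
  shows "x * y - x' * y' \<in> two_sided_ideal R"
proof -
  have "x * y - x' * y' = (x - x') * y + x' * (y - y')"
    by (simp add: algebra_simps)
  then show ?thesis
    using assms by (metis two_sided_ideal.add two_sided_ideal.mult_left two_sided_ideal.mult_right)
qed

text \<open>
  A presentation is a type of generators together with a set of elements of the free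
  algebra on them that are to become zero (a relation \<open>l = r\<close> is encoded as \<open>l - r\<close>).
  The class carries no axioms: it only attaches the relators to the generator type, so that
  the presented algebra is again a type.
\<close>

class presentation =
  fixes relators :: "'a free_algebra set"

quotient_type (overloaded) 'g presented_algebra =
    "'g::presentation free_algebra" / "\<lambda>x y. x - y \<in> two_sided_ideal relators"
proof (rule equivpI)
  show "reflp (\<lambda>x y :: 'g free_algebra. x - y \<in> two_sided_ideal relators)"
    by (simp add: reflp_def two_sided_ideal.zero)
  show "symp (\<lambda>x y :: 'g free_algebra. x - y \<in> two_sided_ideal relators)"
    by (rule sympI) (rule two_sided_ideal_minus_commute)
  show "transp (\<lambda>x y :: 'g free_algebra. x - y \<in> two_sided_ideal relators)"
    by (rule transpI) (rule two_sided_ideal_minus_trans)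
qed

instantiation presented_algebra :: (presentation) "{zero, one, plus, minus, uminus, times}"
begin

lift_definition zero_presented_algebra :: "'a presented_algebra" is 0 .

lift_definition one_presented_algebra :: "'a presented_algebra" is 1 .

lift_definition plus_presented_algebra ::
    "'a presented_algebra \<Rightarrow> 'a presented_algebra \<Rightarrow> 'a presented_algebra" is "(+)"
  unfolding add_diff_add by (rule two_sided_ideal.add)

lift_definition uminus_presented_algebra ::
    "'a presented_algebra \<Rightarrow> 'a presented_algebra" is uminus
  by (drule two_sided_ideal_minus_commute) simp

lift_definition minus_presented_algebra ::
    "'a presented_algebra \<Rightarrow> 'a presented_algebra \<Rightarrow> 'a presented_algebra" is "(-)"
proof -
  fix x x' y y' :: "'a free_algebra"
  assume "x - x' \<in> two_sided_ideal relators" "y - y' \<in> two_sided_ideal relators"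
  then have "(x - x') + (y' - y) \<in> two_sided_ideal relators"
    by (metis two_sided_ideal.add two_sided_ideal_minus_commute)
  then show "(x - y) - (x' - y') \<in> two_sided_ideal relators"
    by (simp add: algebra_simps)
qed

lift_definition times_presented_algebra ::
    "'a presented_algebra \<Rightarrow> 'a presented_algebra \<Rightarrow> 'a presented_algebra" is "(*)"
  by (rule two_sided_ideal_minus_mult)

instance ..

end

instantiation presented_algebra :: (presentation) complex_algebra_1
begin

lift_definition scaleC_presented_algebra ::
    "complex \<Rightarrow> 'a presented_algebra \<Rightarrow> 'a presented_algebra" is "\<lambda>c x. free_const c * x"
  unfolding right_diff_distrib [symmetric] by (rule two_sided_ideal.mult_left)

instance
proof
  fix a b c :: "'a presented_algebra"
  fix k l :: complex
  show "a + b + c = a + (b + c)"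
    by transfer (simp add: add.assoc two_sided_ideal.zero)
  show "a + b = b + a"
    by transfer (simp add: add.commute two_sided_ideal.zero)
  show "0 + a = a"
    by transfer (simp add: two_sided_ideal.zero)
  show "- a + a = 0"
    by transfer (simp add: two_sided_ideal.zero)
  show "a - b = a + - b"
    by transfer (simp add: two_sided_ideal.zero)
  show "a * b * c = a * (b * c)"
    by transfer (simp add: mult.assoc two_sided_ideal.zero)
  show "1 * a = a"
    by transfer (simp add: two_sided_ideal.zero)
  show "a * 1 = a"
    by transfer (simp add: two_sided_ideal.zero)
  show "(a + b) * c = a * c + b * c"
    by transfer (simp add: distrib_right two_sided_ideal.zero)
  show "a * (b + c) = a * b + a * c"
    by transfer (simp add: distrib_left two_sided_ideal.zero)
  show "k *\<^sub>C (a + b) = k *\<^sub>C a + k *\<^sub>C b"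
    by transfer (simp add: distrib_left two_sided_ideal.zero)
  show "(k + l) *\<^sub>C a = k *\<^sub>C a + l *\<^sub>C a"
    by transfer (simp add: free_const_add distrib_right two_sided_ideal.zero)
  show "k *\<^sub>C l *\<^sub>C a = (k * l) *\<^sub>C a"
    by transfer (simp add: free_const_mult mult.assoc two_sided_ideal.zero)
  show "1 *\<^sub>C a = a"
    by transfer (simp add: free_const_1 two_sided_ideal.zero)
  show "(k *\<^sub>C a) * b = k *\<^sub>C (a * b)"
    by transfer (simp add: mult.assoc two_sided_ideal.zero)
  show "a * (k *\<^sub>C b) = k *\<^sub>C (a * b)"
    by transfer (simp add: free_const_left_commute two_sided_ideal.zero)
qed

end

lift_definition presented_gen :: "'g::presentation \<Rightarrow> 'g presented_algebra" is free_gen .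


section \<open>The universal enveloping algebra of sl2\<close>

datatype sl2_generator = Gen_E | Gen_F | Gen_H

instantiation sl2_generator :: presentation
begin

definition relators_sl2_generator :: "sl2_generator free_algebra set" where
  "relators_sl2_generator =
    (let E = free_gen Gen_E; F = free_gen Gen_F; H = free_gen Gen_H in
     {commutator H E - 2 * E, commutator H F - (- 2 * F), commutator E F - H})"

instance ..

end

type_synonym U_sl2 = "sl2_generator presented_algebra"

definition sl2_E :: U_sl2 where "sl2_E = presented_gen Gen_E"
definition sl2_F :: U_sl2 where "sl2_F = presented_gen Gen_F"
definition sl2_H :: U_sl2 where "sl2_H = presented_gen Gen_H"

definition sl2_Casimir :: U_sl2 where
  "sl2_Casimir = sl2_E * sl2_F + sl2_F * sl2_E + (1 / 2) *\<^sub>C sl2_H\<^sup>2"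


section \<open>The universal Hahn algebra\<close>

text \<open>
  The expressions for \<open>\<alpha>\<close> and \<open>\<beta>\<close> are stated for an arbitrary ring with unit, since they occur both in
  the free algebra (in the relators) and in the universal Hahn algebra itself.
\<close>

definition hahn_alpha_expr :: "'a::{ring,semiring_numeral} \<Rightarrow> 'a \<Rightarrow> 'a \<Rightarrow> 'a" where
  "hahn_alpha_expr A B C = commutator C A + 2 * A\<^sup>2 + B"

definition hahn_beta_expr :: "'a::{ring,semiring_numeral} \<Rightarrow> 'a \<Rightarrow> 'a \<Rightarrow> 'a" where
  "hahn_beta_expr A B C = commutator B C + 4 * B * A + 2 * C"

datatype hahn_generator = Gen_A | Gen_B | Gen_C

instantiation hahn_generator :: presentation
begin

definition relators_hahn_generator :: "hahn_generator free_algebra set" where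
  "relators_hahn_generator =
    (let A = free_gen Gen_A; B = free_gen Gen_B; C = free_gen Gen_C in
     {commutator A B - C} \<union>
     {commutator z x | z x. z \<in> {hahn_alpha_expr A B C, hahn_beta_expr A B C} \<and> x \<in> {A, B, C}})"

instance ..

end

type_synonym hahn_algebra = "hahn_generator presented_algebra"

definition hahn_A :: hahn_algebra where "hahn_A = presented_gen Gen_A"
definition hahn_B :: hahn_algebra where "hahn_B = presented_gen Gen_B"
definition hahn_C :: hahn_algebra where "hahn_C = presented_gen Gen_C"

definition hahn_alpha :: hahn_algebra where
  "hahn_alpha = hahn_alpha_expr hahn_A hahn_B hahn_C"

definition hahn_beta :: hahn_algebra where
  "hahn_beta = hahn_beta_expr hahn_A hahn_B hahn_C"

end

theory Submission
  imports Defs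
begin

text \<open>
  A homomorphism out of an algebra given by generators and relations is the same thing as a choice
  of images of the generators that satisfies the relations
  (\<open>presented_algebra_hom_exists\<close>, \<open>presented_algebra_hom_unique\<close>). Uniqueness of \<open>\<natural>\<close> is therefore
  immediate, since the images of \<open>A\<close>, \<open>B\<close>, \<open>C\<close> are prescribed. For existence it suffices to check,
  for the prescribed elements \<open>a\<close>, \<open>b\<close>, \<open>c\<close> of \<open>U(sl2)\<close>, that \<open>[a, b] = c\<close> and that the expressions
  for \<open>\<alpha>\<close> and \<open>\<beta>\<close> in \<open>a\<close>, \<open>b\<close>, \<open>c\<close> evaluate to \<open>(\<Lambda> - 1) / 4\<close> and \<open>0\<close>: both are then central,
  because \<open>\<Lambda>\<close> is, and the prescribed values at \<open>\<alpha>\<close> and \<open>\<beta>\<close> come out as well.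

  The element \<open>a = H / 4\<close> acts by commutator on \<open>E\<^sup>2\<close> and \<open>F\<^sup>2\<close> with eigenvalues \<open>1\<close> and \<open>-1\<close>. This
  gives \<open>[a, b] = (E\<^sup>2 - F\<^sup>2) / 4 = c\<close> and \<open>[c, a] = - (E\<^sup>2 + F\<^sup>2) / 4\<close>; adding \<open>2 a\<^sup>2 + b\<close> leaves
  \<open>(\<Lambda> - 1) / 4\<close>. In the expression for \<open>\<beta>\<close> the terms of weights \<open>4\<close> and \<open>-4\<close> cancel, and what
  remains is the identity \<open>[E\<^sup>2, F\<^sup>2] = 2 (\<Lambda> - 1) H - H\<^sup>3\<close>. These identities use only the three
  commutation relations, so they are proved for any \<open>sl2\<close>-triple in an algebra, by rewriting all
  monomials to the normal order \<open>F\<close>, \<open>E\<close>, \<open>H\<close> (\<open>casimir_commute_generators\<close>,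
  \<open>commutator_image_A_image_B\<close>, \<open>hahn_alpha_image\<close>, \<open>hahn_beta_image\<close>).
\<close>

section \<open>Linear arithmetic in a complex algebra\<close>

interpretation complex_algebra_module: vector_space "scaleC :: complex \<Rightarrow> 'a::complex_algebra_1 \<Rightarrow> 'a"
  by standard (simp_all add: scaleC_add_right scaleC_add_left scaleC_scaleC scaleC_one)

lemma scaleC_Bit0: "numeral (num.Bit0 n) *\<^sub>C x = numeral n *\<^sub>C x + numeral n *\<^sub>C x"
  by (simp only: numeral_Bit0 scaleC_add_left)

lemma scaleC_Bit1: "numeral (num.Bit1 n) *\<^sub>C x = numeral n *\<^sub>C x + numeral n *\<^sub>C x + x"
  by (simp only: numeral_Bit1 scaleC_add_left scaleC_one)

lemma numeral_mult_eq_scaleC: "numeral n * x = numeral n *\<^sub>C (x::'a::complex_algebra_1)"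
proof (induction n)
  case One
  show ?case by (simp add: scaleC_one)
next
  case (Bit0 n)
  then show ?case by (simp only: scaleC_Bit0 numeral_Bit0[where 'a = 'a] distrib_right)
next
  case (Bit1 n)
  then show ?case
    by (simp only: scaleC_Bit1 numeral_Bit1[where 'a = 'a] distrib_right mult_1_left)
qed

text \<open>
  The simplifier cancels equal summands in a ring but does not collect complex coefficients.
  An identity with rational coefficients is therefore multiplied by a common denominator, after
  which these rules write every integer multiple as a repeated sum.
\<close>

lemmas scaleC_numeral_expand = scaleC_Bit0 scaleC_Bit1 scaleC_one numeral_mult_eq_scaleC

lemmas scaleC_ring_simps = mult_scaleC_left mult_scaleC_right scaleC_scaleC
  complex_algebra_module.scale_right_distrib complex_algebra_module.scale_right_diff_distrib

lemma complex_algebra_hom_diff: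
  assumes "complex_algebra_hom h"
  shows "h (x - y) = h x - h y"
  using assms unfolding complex_algebra_hom_def by (metis add_diff_cancel diff_add_cancel)

lemma complex_algebra_hom_numeral:
  fixes h :: "'a::complex_algebra_1 \<Rightarrow> 'b::complex_algebra_1"
  assumes "complex_algebra_hom h"
  shows "h (numeral n) = numeral n"
proof -
  have "h (numeral n *\<^sub>C 1) = numeral n *\<^sub>C h 1" "h 1 = 1"
    using assms by (simp_all add: complex_algebra_hom_def)
  then show ?thesis
    by (simp flip: numeral_mult_eq_scaleC)
qed


section \<open>Evaluation of free algebra elements\<close>

definition word_value :: "('g \<Rightarrow> 'a::complex_algebra_1) \<Rightarrow> 'g word \<Rightarrow> 'a" where
  "word_value \<phi> w = prod_list (map \<phi> (letters w))"

definition free_eval :: "('g \<Rightarrow> 'a::complex_algebra_1) \<Rightarrow> 'g free_algebra \<Rightarrow> 'a" where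
  "free_eval \<phi> p = (\<Sum>w\<in>Poly_Mapping.keys p. Poly_Mapping.lookup p w *\<^sub>C word_value \<phi> w)"

lemma word_value_zero: "word_value \<phi> 0 = 1"
  by (simp add: word_value_def zero_word_def)

lemma word_value_plus: "word_value \<phi> (u + v) = word_value \<phi> u * word_value \<phi> v"
  by (simp add: word_value_def plus_word_def)

text \<open>
  Sums over two different supports can only be compared over a common index set; this is what
  makes evaluation additive even though coefficients may cancel.
\<close>

lemma free_eval_superset:
  assumes "finite S" "Poly_Mapping.keys p \<subseteq> S"
  shows "free_eval \<phi> p = (\<Sum>w\<in>S. Poly_Mapping.lookup p w *\<^sub>C word_value \<phi> w)"
  unfolding free_eval_def
  by (rule sum.mono_neutral_left) (use assms in \<open>auto simp: in_keys_iff\<close>)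

lemma free_eval_zero: "free_eval \<phi> 0 = 0"
  by (simp add: free_eval_def)

lemma free_eval_add: "free_eval \<phi> (p + q) = free_eval \<phi> p + free_eval \<phi> q"
proof -
  let ?S = "Poly_Mapping.keys p \<union> Poly_Mapping.keys q"
  have "Poly_Mapping.keys (p + q) \<subseteq> ?S"
    by (rule Poly_Mapping.keys_add)
  then show ?thesis
    by (simp add: free_eval_superset[of ?S] lookup_add scaleC_add_left sum.distrib)
qed

lemma free_eval_diff: "free_eval \<phi> (p - q) = free_eval \<phi> p - free_eval \<phi> q"
  using free_eval_add[of \<phi> "p - q" q] by simp

lemma free_eval_single: "free_eval \<phi> (Poly_Mapping.single w c) = c *\<^sub>C word_value \<phi> w"
  by (simp add: free_eval_def)

lemma free_algebra_induct [case_names zero monomial]: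
  fixes p :: "'g free_algebra"
  assumes "P 0" "\<And>p w c. P p \<Longrightarrow> P (p + Poly_Mapping.single w c)"
  shows "P p"
proof (induction p rule: update_induct)
  case const
  show ?case using assms(1) by simp
next
  case (update p w c)
  have "Poly_Mapping.update w c p = p + Poly_Mapping.single w c"
    using update.hyps(1)
    by (intro poly_mapping_eqI) (auto simp: lookup_update lookup_add lookup_single in_keys_iff)
  then show ?case
    using assms(2) update.IH by simp
qed

text \<open>
  By bilinearity multiplicativity reduces to a product of two monomials, where concatenation of
  words turns into multiplication of their values.
\<close>

lemma free_eval_mult: "free_eval \<phi> (p * q) = free_eval \<phi> p * free_eval \<phi> q"
proof (induction p rule: free_algebra_induct)
  case zero
  show ?case by (simp add: free_eval_zero)
next
  case (monomial p u c)
  have "free_eval \<phi> (Poly_Mapping.single u c * q) =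
      free_eval \<phi> (Poly_Mapping.single u c) * free_eval \<phi> q"
    by (induction q rule: free_algebra_induct)
      (simp_all add: free_eval_zero free_eval_add free_eval_single mult_single word_value_plus
        distrib_left mult_scaleC_left mult_scaleC_right scaleC_scaleC)
  with monomial show ?case
    by (simp add: distrib_right free_eval_add)
qed

lemma free_eval_const: "free_eval \<phi> (free_const c) = c *\<^sub>C 1"
  by (simp add: free_const_def free_eval_single word_value_zero)

lemma free_eval_one: "free_eval \<phi> 1 = 1"
  using free_eval_const[of \<phi> 1] by (simp add: free_const_1 scaleC_one)

lemma free_eval_numeral: "free_eval \<phi> (numeral n) = numeral n"
  by (induction n) (simp_all only: numeral.simps free_eval_add free_eval_one)

lemma free_eval_gen: "free_eval \<phi> (free_gen g) = \<phi> g"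
  by (simp add: free_gen_def free_eval_single word_value_def scaleC_one)

lemma free_eval_commutator:
  "free_eval \<phi> (commutator p q) = commutator (free_eval \<phi> p) (free_eval \<phi> q)"
  by (simp add: commutator_def free_eval_diff free_eval_mult)

lemmas free_eval_simps = free_eval_add free_eval_diff free_eval_mult
  free_eval_numeral free_eval_gen free_eval_commutator


section \<open>The universal property of a presented algebra\<close>

lemma free_eval_ideal:
  assumes "\<And>r. r \<in> R \<Longrightarrow> free_eval \<phi> r = 0" "x \<in> two_sided_ideal R"
  shows "free_eval \<phi> x = 0"
  using assms(2) by induction (simp_all add: assms(1) free_eval_zero free_eval_add free_eval_mult)

lemma presented_algebra_cases:
  obtains p where "x = abs_presented_algebra p"
  by (induction x rule: presented_algebra.abs_induct) blast

text \<open>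
  Evaluation vanishes on the ideal generated by the relators, so its value at an arbitrary
  representative of a class defines a map on the quotient.
\<close>

lemma presented_algebra_hom_exists:
  fixes \<phi> :: "'g::presentation \<Rightarrow> 'a::complex_algebra_1"
  assumes "\<And>r. r \<in> relators \<Longrightarrow> free_eval \<phi> r = 0"
  shows "\<exists>h. complex_algebra_hom h \<and> (\<forall>g. h (presented_gen g) = \<phi> g)"
proof -
  define h where "h x = free_eval \<phi> (rep_presented_algebra x)" for x
  have h: "h (abs_presented_algebra p) = free_eval \<phi> p" for p
  proof -
    have "rep_presented_algebra (abs_presented_algebra p) - p \<in> two_sided_ideal relators"
      using Quotient_rep_abs[OF Quotient_presented_algebra] by (simp add: two_sided_ideal.zero)
    from free_eval_ideal[OF assms this] show ?thesis
      by (simp add: h_def free_eval_diff)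
  qed
  have "h (x + y) = h x + h y" for x y
    by (cases x rule: presented_algebra_cases; cases y rule: presented_algebra_cases)
      (simp add: h plus_presented_algebra.abs_eq free_eval_add)
  moreover have "h (c *\<^sub>C x) = c *\<^sub>C h x" for c x
    by (cases x rule: presented_algebra_cases)
      (simp add: h scaleC_presented_algebra.abs_eq free_eval_mult free_eval_const mult_scaleC_left)
  moreover have "h (x * y) = h x * h y" for x y
    by (cases x rule: presented_algebra_cases; cases y rule: presented_algebra_cases)
      (simp add: h times_presented_algebra.abs_eq free_eval_mult)
  moreover have "h 1 = 1"
    by (simp add: h one_presented_algebra_def free_eval_one)
  moreover have "h (presented_gen g) = \<phi> g" for g
    by (simp add: h presented_gen.abs_eq free_eval_gen)
  ultimately show ?thesis
    unfolding complex_algebra_hom_def by blast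
qed

text \<open>
  The products of generators span the algebra, and a homomorphism is determined on each such product
  by its values at the generators.
\<close>

lemma presented_algebra_hom_unique:
  fixes h k :: "'g::presentation presented_algebra \<Rightarrow> 'a::complex_algebra_1"
  assumes "complex_algebra_hom h" "complex_algebra_hom k"
    and gen: "\<And>g. h (presented_gen g) = k (presented_gen g)"
  shows "h = k"
proof
  fix x
  note hom = assms(1,2)[unfolded complex_algebra_hom_def]
  have word: "h (abs_presented_algebra (Poly_Mapping.single (Word gs) 1)) =
      k (abs_presented_algebra (Poly_Mapping.single (Word gs) 1))" for gs
  proof (induction gs)
    case Nil
    have "abs_presented_algebra (Poly_Mapping.single (Word []) 1) = (1 :: 'g presented_algebra)"
      by (simp add: one_presented_algebra_def flip: zero_word_def)
    then show ?case
      using hom by simp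
  next
    case (Cons g gs)
    have "abs_presented_algebra (Poly_Mapping.single (Word (g # gs)) 1) =
        presented_gen g * abs_presented_algebra (Poly_Mapping.single (Word gs) 1)"
      by (simp add: presented_gen.abs_eq times_presented_algebra.abs_eq free_gen_def mult_single
          plus_word_def)
    then show ?case
      using hom gen Cons by simp
  qed
  have "h (abs_presented_algebra p) = k (abs_presented_algebra p)" for p
  proof (induction p rule: free_algebra_induct)
    case zero
    have "h 0 = 0" "k 0 = 0"
      using hom by (metis add_cancel_right_right)+
    then show ?case
      by (simp flip: zero_presented_algebra_def)
  next
    case (monomial p w c)
    have "abs_presented_algebra (p + Poly_Mapping.single w c) =
        abs_presented_algebra p + c *\<^sub>C abs_presented_algebra (Poly_Mapping.single w 1)"
      by (simp add: plus_presented_algebra.abs_eq scaleC_presented_algebra.abs_eq free_const_def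
          mult_single)
    then show ?case
      using hom monomial word[of "letters w"] by simp
  qed
  then show "h x = k x"
    by (cases x rule: presented_algebra_cases) simp
qed

lemma presented_algebra_relator:
  "r \<in> relators \<Longrightarrow> abs_presented_algebra r = 0"
  by (simp add: zero_presented_algebra_def presented_algebra.abs_eq_iff two_sided_ideal.gen)


section \<open>Homomorphisms out of the universal Hahn algebra\<close>

lemma hahn_algebra_hom_exists:
  fixes a b c :: "'a::complex_algebra_1"
  assumes "commutator a b = c"
    and "\<And>x. x \<in> {a, b, c} \<Longrightarrow> commutator (hahn_alpha_expr a b c) x = 0"
    and "\<And>x. x \<in> {a, b, c} \<Longrightarrow> commutator (hahn_beta_expr a b c) x = 0"
  shows "\<exists>h. complex_algebra_hom h \<and> h hahn_A = a \<and> h hahn_B = b \<and> h hahn_C = c"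
proof -
  define \<phi> where "\<phi> = case_hahn_generator a b c"
  have "free_eval \<phi> r = 0" if "r \<in> relators" for r
    using that assms
    by (auto simp: relators_hahn_generator_def Let_def free_eval_simps hahn_alpha_expr_def
        hahn_beta_expr_def power2_eq_square \<phi>_def)
  from presented_algebra_hom_exists[OF this] obtain h
    where "complex_algebra_hom h" "\<And>g. h (presented_gen g) = \<phi> g" by blast
  then show ?thesis
    by (intro exI[of _ h]) (simp add: hahn_A_def hahn_B_def hahn_C_def \<phi>_def)
qed

lemma hahn_algebra_hom_unique:
  fixes h k :: "hahn_algebra \<Rightarrow> 'a::complex_algebra_1"
  assumes "complex_algebra_hom h" "complex_algebra_hom k"
    and "h hahn_A = k hahn_A" "h hahn_B = k hahn_B" "h hahn_C = k hahn_C"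
  shows "h = k"
proof (rule presented_algebra_hom_unique[OF assms(1,2)])
  fix g
  show "h (presented_gen g) = k (presented_gen g)"
    using assms(3-5) by (cases g) (simp_all add: hahn_A_def hahn_B_def hahn_C_def)
qed

lemma hom_hahn_alpha:
  assumes "complex_algebra_hom h"
  shows "h hahn_alpha = hahn_alpha_expr (h hahn_A) (h hahn_B) (h hahn_C)"
  using assms complex_algebra_hom_diff[OF assms] complex_algebra_hom_numeral[OF assms]
  by (simp add: hahn_alpha_def hahn_alpha_expr_def commutator_def power2_eq_square
      complex_algebra_hom_def)

lemma hom_hahn_beta:
  assumes "complex_algebra_hom h"
  shows "h hahn_beta = hahn_beta_expr (h hahn_A) (h hahn_B) (h hahn_C)"
  using assms complex_algebra_hom_diff[OF assms] complex_algebra_hom_numeral[OF assms]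
  by (simp add: hahn_beta_def hahn_beta_expr_def commutator_def complex_algebra_hom_def)


section \<open>Identities for an sl2-triple\<close>

locale sl2_triple =
  fixes E F H :: "'a::complex_algebra_1"
  assumes commutator_H_E: "commutator H E = 2 * E"
    and commutator_H_F: "commutator H F = - (2 * F)"
    and commutator_E_F: "commutator E F = H"
begin

lemma H_E: "H * E = E * H + E + E"
  using commutator_H_E by (simp add: commutator_def scaleC_numeral_expand algebra_simps)

lemma H_F: "H * F = F * H - F - F"
  using commutator_H_F by (simp add: commutator_def scaleC_numeral_expand algebra_simps)

lemma E_F: "E * F = F * E + H"
  using commutator_E_F by (simp add: commutator_def algebra_simps)

lemma H_E_left: "H * (E * x) = E * (H * x) + E * x + E * x"
  by (simp add: H_E distrib_right flip: mult.assoc)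

lemma H_F_left: "H * (F * x) = F * (H * x) - F * x - F * x"
  by (simp add: H_F left_diff_distrib flip: mult.assoc)

lemma E_F_left: "E * (F * x) = F * (E * x) + H * x"
  by (simp add: E_F distrib_right flip: mult.assoc)

text \<open>
  These rules bring every monomial into the form \<open>F\<^sup>i E\<^sup>j H\<^sup>k\<close>, as in the
  Poincare-Birkhoff-Witt theorem. The variants with a trailing factor \<open>x\<close> rewrite inside
  products associated to the right.
\<close>

lemmas normal_order = H_E H_F E_F H_E_left H_F_left E_F_left

definition casimir :: 'a where
  "casimir = E * F + F * E + (1 / 2) *\<^sub>C H\<^sup>2"

lemma casimir_commute_generators:
  "casimir * E = E * casimir" "casimir * F = F * casimir" "casimir * H = H * casimir"
proof -
  have "2 *\<^sub>C (casimir * E) = 2 *\<^sub>C (E * casimir)"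
    "2 *\<^sub>C (casimir * F) = 2 *\<^sub>C (F * casimir)"
    "2 *\<^sub>C (casimir * H) = 2 *\<^sub>C (H * casimir)"
    by (simp_all add: casimir_def power2_eq_square normal_order scaleC_ring_simps
        scaleC_numeral_expand algebra_simps)
  then show "casimir * E = E * casimir" "casimir * F = F * casimir" "casimir * H = H * casimir"
    by simp_all
qed

definition image_A :: 'a where
  "image_A = (1 / 4) *\<^sub>C H"

definition image_B :: 'a where
  "image_B = (1 / 4) *\<^sub>C (E\<^sup>2 + F\<^sup>2 + casimir - 1) - (1 / 8) *\<^sub>C H\<^sup>2"

definition image_C :: 'a where
  "image_C = (1 / 4) *\<^sub>C (E\<^sup>2 - F\<^sup>2)"

lemmas image_defs = image_A_def image_B_def image_C_def

lemma casimir_commute_images: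
  assumes "x \<in> {image_A, image_B, image_C}"
  shows "casimir * x = x * casimir"
proof -
  have "casimir * E\<^sup>2 = E\<^sup>2 * casimir" "casimir * F\<^sup>2 = F\<^sup>2 * casimir" "casimir * H\<^sup>2 = H\<^sup>2 * casimir"
    unfolding power2_eq_square by (metis casimir_commute_generators mult.assoc)+
  then have "casimir * image_A = image_A * casimir" "casimir * image_B = image_B * casimir"
    "casimir * image_C = image_C * casimir"
    using casimir_commute_generators(3)
    by (simp_all add: image_defs scaleC_ring_simps algebra_simps)
  then show ?thesis
    using assms by blast
qed

lemma commutator_image_A_image_B: "commutator image_A image_B = image_C"
proof -
  have "16 *\<^sub>C commutator image_A image_B = 16 *\<^sub>C image_C"
    unfolding commutator_def image_defs casimir_def
    by (simp add: power2_eq_square normal_order scaleC_ring_simps scaleC_numeral_expand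
        algebra_simps)
  then show ?thesis by simp
qed

lemma hahn_alpha_image: "hahn_alpha_expr image_A image_B image_C = (1 / 4) *\<^sub>C (casimir - 1)"
proof -
  have "16 *\<^sub>C hahn_alpha_expr image_A image_B image_C = 16 *\<^sub>C (1 / 4) *\<^sub>C (casimir - 1)"
    unfolding hahn_alpha_expr_def commutator_def image_defs casimir_def
    by (simp add: power2_eq_square normal_order scaleC_ring_simps scaleC_numeral_expand
        algebra_simps)
  then show ?thesis
    unfolding complex_algebra_module.scale_cancel_left by simp
qed

lemma hahn_beta_image: "hahn_beta_expr image_A image_B image_C = 0"
proof -
  have "32 *\<^sub>C hahn_beta_expr image_A image_B image_C = 0"
    unfolding hahn_beta_expr_def commutator_def image_defs casimir_def
    by (simp add: power2_eq_square normal_order scaleC_ring_simps scaleC_numeral_expand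
        algebra_simps)
  then show ?thesis by simp
qed

lemma hahn_hom_exists:
  "\<exists>h. complex_algebra_hom h \<and> h hahn_A = image_A \<and> h hahn_B = image_B \<and> h hahn_C = image_C"
proof (rule hahn_algebra_hom_exists[OF commutator_image_A_image_B])
  fix x assume "x \<in> {image_A, image_B, image_C}"
  then show "commutator (hahn_alpha_expr image_A image_B image_C) x = 0"
    using casimir_commute_images[of x]
    by (simp add: hahn_alpha_image commutator_def mult_scaleC_left mult_scaleC_right
        left_diff_distrib right_diff_distrib)
  show "commutator (hahn_beta_expr image_A image_B image_C) x = 0"
    by (simp add: hahn_beta_image commutator_def)
qed

end


section \<open>The homomorphism to the universal enveloping algebra\<close>

lemma sl2_triple_generators: "sl2_triple sl2_E sl2_F sl2_H"
proof -
  have two: "abs_presented_algebra 2 = (2 :: U_sl2)"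
    by (simp only: one_add_one[symmetric] one_presented_algebra_def plus_presented_algebra.abs_eq)
  note presentation_simps = commutator_def sl2_E_def sl2_F_def sl2_H_def presented_gen.abs_eq two
    times_presented_algebra.abs_eq[symmetric] minus_presented_algebra.abs_eq[symmetric]
    plus_presented_algebra.abs_eq[symmetric]
  let ?E = "free_gen Gen_E" and ?F = "free_gen Gen_F" and ?H = "free_gen Gen_H"
  have "abs_presented_algebra (commutator ?H ?E - 2 * ?E) = 0"
    "abs_presented_algebra (commutator ?H ?F + 2 * ?F) = 0"
    "abs_presented_algebra (commutator ?E ?F - ?H) = 0"
    by (rule presented_algebra_relator; simp add: relators_sl2_generator_def Let_def)+
  then show ?thesis
    by unfold_locales (simp_all add: presentation_simps eq_neg_iff_add_eq_0)
qed

theorem theorem1p3: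
  shows "\<exists>!h :: hahn_algebra \<Rightarrow> U_sl2.
    complex_algebra_hom h \<and>
    h hahn_A = (1 / 4) *\<^sub>C sl2_H \<and>
    h hahn_B = (1 / 4) *\<^sub>C (sl2_E\<^sup>2 + sl2_F\<^sup>2 + sl2_Casimir - 1) - (1 / 8) *\<^sub>C sl2_H\<^sup>2 \<and>
    h hahn_C = (1 / 4) *\<^sub>C (sl2_E\<^sup>2 - sl2_F\<^sup>2) \<and>
    h hahn_alpha = (1 / 4) *\<^sub>C (sl2_Casimir - 1) \<and>
    h hahn_beta = 0"
proof -
  interpret sl2_triple sl2_E sl2_F sl2_H
    by (rule sl2_triple_generators)
  have casimir: "casimir = sl2_Casimir"
    by (simp add: casimir_def sl2_Casimir_def)
  obtain h where h: "complex_algebra_hom h"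
    "h hahn_A = image_A" "h hahn_B = image_B" "h hahn_C = image_C"
    using hahn_hom_exists by blast
  show ?thesis
    unfolding casimir[symmetric] image_defs[symmetric]
  proof (rule ex1I[of _ h])
    show "complex_algebra_hom h \<and> h hahn_A = image_A \<and> h hahn_B = image_B \<and> h hahn_C = image_C \<and>
        h hahn_alpha = (1 / 4) *\<^sub>C (casimir - 1) \<and> h hahn_beta = 0"
      using h by (simp add: hom_hahn_alpha hom_hahn_beta hahn_alpha_image hahn_beta_image)
  next
    fix k
    assume "complex_algebra_hom k \<and> k hahn_A = image_A \<and> k hahn_B = image_B \<and> k hahn_C = image_C \<and>
        k hahn_alpha = (1 / 4) *\<^sub>C (casimir - 1) \<and> k hahn_beta = 0"
    then show "k = h"
      using h by (intro hahn_algebra_hom_unique) simp_all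
  qed
qed

end
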